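(* Let $H(X)$ be a Hilbert function space on a set $X$ with kernel $K$, and for $\lambda\in X$ let $k_\lambda\in H(X)$ be the reproducing kernel at $\lambda$. Suppose that for every finite set of distinct points $\lambda_1,\dots,\lambda_N\in X$ and all non-zero scalars $a_1,\dots,a_N\in\mathbb{C}$, the complement in $X$ of the zero set of the function $G(x)=a_1k_{\lambda_1}(x)+\dots+a_Nk_{\lambda_N}(x)$ is a set of uniqueness for $\mathrm{Mult}(H(X))$. Then $K$ is a Pick uniqueness kernel.
   Context: A Hilbert function space $H(X)$ is a Hilbert space of complex-valued functions on a set $X$ in which evaluation at each point $\lambda\in X$ is a bounded linear functional; the reproducing kernel $k_\lambda\in H(X)$ is the element with $\langle f,k_\lambda\rangle=f(\lambda)$ for all $f\in H(X)$. The multiplier algebra $\mathrm{Mult}(H(X))$ is the normed algebra of functions $\phi$ on $X$ with $\phi f\in H(X)$ for each $f\in H(X)$, with norm $\|\phi\|=\|M_\phi\|$, where $M_\phi f=\phi f$ is the (bounded) multiplication operator on $H(X)$. $\mathrm{Mult}_1(H(X))$ is the closed unit ball of $\mathrm{Mult}(H(X))$. A set $\Omega\subset X$ is a set of uniqueness for $\mathrm{Mult}(H(X))$ if, whenever $\phi_1,\phi_2\in\mathrm{Mult}(H(X))$ and $\phi_1=\phi_2$ on $\Omega$, one has $\phi_1=\phi_2$ in $\mathrm{Mult}(H(X))$. A Nevanlinna-Pick problem on $H(X)$ is given by distinct nodes $\lambda_1,\dots,\lambda_N\in X$ and target points $\omega_1,\dots,\omega_N\in\mathbb{D}$ (the open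 unit disc). A solution is a $\phi\in\mathrm{Mult}_1(H(X))$ with $\phi(\lambda_i)=\omega_i$ for each $i$; the problem is solvable if a solution exists. Its Pick matrix is the $N\times N$ matrix $W\cdot K=\big((1-\omega_i\overline{\omega_j})k_{ij}\big)_{i,j=1}^N$, where $k_{ij}=\langle k_{\lambda_j},k_{\lambda_i}\rangle$. The kernel $K$ of $H(X)$ is a Pick uniqueness kernel if the following holds for each solvable Nevanlinna-Pick problem on $H(X)$: if the Pick matrix of the problem is singular, then the problem has a unique solution. *)

theory Defs
  imports Complex_Main "HOL-Library.Extended_Real" "Jordan_Normal_Form.Determinant"
begin

text \<open>
  A complex-valued function on a set \<open>X\<close> is represented by its extension by \<open>0\<close> to the whole
  ambient type, so that equality of functions on \<open>X\<close> is equality in HOL.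
\<close>

definition funs_on :: "'x set \<Rightarrow> ('x \<Rightarrow> complex) set" where
  "funs_on X = {f. \<forall>x. x \<notin> X \<longrightarrow> f x = 0}"

definition ip_norm :: "(('x \<Rightarrow> complex) \<Rightarrow> ('x \<Rightarrow> complex) \<Rightarrow> complex) \<Rightarrow> ('x \<Rightarrow> complex) \<Rightarrow> real" where
  "ip_norm ip f = sqrt (Re (ip f f))"

text \<open>
  The inner product is linear in its first argument; its values outside \<open>H\<close> are irrelevant.
\<close>

locale hilbert_function_space =
  fixes X :: "'x set"
    and H :: "('x \<Rightarrow> complex) set"
    and ip :: "('x \<Rightarrow> complex) \<Rightarrow> ('x \<Rightarrow> complex) \<Rightarrow> complex"
  assumes funs: "H \<subseteq> funs_on X"
    and zero_mem: "(\<lambda>x. 0) \<in> H"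
    and add_mem: "\<lbrakk>f \<in> H; g \<in> H\<rbrakk> \<Longrightarrow> (\<lambda>x. f x + g x) \<in> H"
    and scale_mem: "f \<in> H \<Longrightarrow> (\<lambda>x. c * f x) \<in> H"
    and ip_add: "\<lbrakk>f \<in> H; g \<in> H; h \<in> H\<rbrakk> \<Longrightarrow> ip (\<lambda>x. f x + g x) h = ip f h + ip g h"
    and ip_scale: "\<lbrakk>f \<in> H; h \<in> H\<rbrakk> \<Longrightarrow> ip (\<lambda>x. c * f x) h = c * ip f h"
    and ip_cnj: "\<lbrakk>f \<in> H; g \<in> H\<rbrakk> \<Longrightarrow> ip g f = cnj (ip f g)"
    and ip_pos: "\<lbrakk>f \<in> H; f \<noteq> (\<lambda>x. 0)\<rbrakk> \<Longrightarrow> Re (ip f f) > 0"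
    and complete: "\<lbrakk>\<And>n. u n \<in> H;
        \<forall>e>0. \<exists>M. \<forall>m\<ge>M. \<forall>n\<ge>M. ip_norm ip (\<lambda>x. u m x - u n x) < e\<rbrakk>
        \<Longrightarrow> \<exists>f\<in>H. (\<lambda>n. ip_norm ip (\<lambda>x. u n x - f x)) \<longlonglongrightarrow> 0"
    and eval_bounded: "x \<in> X \<Longrightarrow> \<exists>C. \<forall>f\<in>H. cmod (f x) \<le> C * ip_norm ip f"

definition rep_kernel ::
  "('x \<Rightarrow> complex) set \<Rightarrow> (('x \<Rightarrow> complex) \<Rightarrow> ('x \<Rightarrow> complex) \<Rightarrow> complex) \<Rightarrow> 'x \<Rightarrow> 'x \<Rightarrow> complex" where
  "rep_kernel H ip l = (THE k. k \<in> H \<and> (\<forall>f\<in>H. ip f k = f l))"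

definition Mult :: "'x set \<Rightarrow> ('x \<Rightarrow> complex) set \<Rightarrow> ('x \<Rightarrow> complex) set" where
  "Mult X H = {\<phi> \<in> funs_on X. \<forall>f\<in>H. (\<lambda>x. \<phi> x * f x) \<in> H}"

text \<open>
  The operator norm of the multiplication operator. For a multiplier of a Hilbert function space
  the supremum is finite by the closed graph theorem; it is taken in the extended reals
  so that its meaning does not depend on that fact.
\<close>

definition mult_norm ::
  "('x \<Rightarrow> complex) set \<Rightarrow> (('x \<Rightarrow> complex) \<Rightarrow> ('x \<Rightarrow> complex) \<Rightarrow> complex) \<Rightarrow> ('x \<Rightarrow> complex) \<Rightarrow> ereal" where
  "mult_norm H ip \<phi> = (SUP f\<in>{f \<in> H. ip_norm ip f \<le> 1}. ereal (ip_norm ip (\<lambda>x. \<phi> x * f x)))"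

definition Mult1 ::
  "'x set \<Rightarrow> ('x \<Rightarrow> complex) set \<Rightarrow> (('x \<Rightarrow> complex) \<Rightarrow> ('x \<Rightarrow> complex) \<Rightarrow> complex) \<Rightarrow> ('x \<Rightarrow> complex) set" where
  "Mult1 X H ip = {\<phi> \<in> Mult X H. mult_norm H ip \<phi> \<le> 1}"

definition uniqueness_set :: "'x set \<Rightarrow> ('x \<Rightarrow> complex) set \<Rightarrow> 'x set \<Rightarrow> bool" where
  "uniqueness_set X H \<Omega> \<longleftrightarrow> \<Omega> \<subseteq> X \<and>
    (\<forall>\<phi>\<^sub>1\<in>Mult X H. \<forall>\<phi>\<^sub>2\<in>Mult X H. (\<forall>x\<in>\<Omega>. \<phi>\<^sub>1 x = \<phi>\<^sub>2 x) \<longrightarrow> \<phi>\<^sub>1 = \<phi>\<^sub>2)"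

text \<open>Nodes and targets are indexed by \<open>0, \<dots>, N - 1\<close>.\<close>

definition np_problem :: "'x set \<Rightarrow> nat \<Rightarrow> (nat \<Rightarrow> 'x) \<Rightarrow> (nat \<Rightarrow> complex) \<Rightarrow> bool" where
  "np_problem X N l \<omega> \<longleftrightarrow>
    N \<ge> 1 \<and> (\<forall>i<N. l i \<in> X) \<and> inj_on l {..<N} \<and> (\<forall>i<N. cmod (\<omega> i) < 1)"

definition np_solution ::
  "'x set \<Rightarrow> ('x \<Rightarrow> complex) set \<Rightarrow> (('x \<Rightarrow> complex) \<Rightarrow> ('x \<Rightarrow> complex) \<Rightarrow> complex) \<Rightarrow>
   nat \<Rightarrow> (nat \<Rightarrow> 'x) \<Rightarrow> (nat \<Rightarrow> complex) \<Rightarrow> ('x \<Rightarrow> complex) \<Rightarrow> bool" where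
  "np_solution X H ip N l \<omega> \<phi> \<longleftrightarrow> \<phi> \<in> Mult1 X H ip \<and> (\<forall>i<N. \<phi> (l i) = \<omega> i)"

definition pick_matrix ::
  "('x \<Rightarrow> complex) set \<Rightarrow> (('x \<Rightarrow> complex) \<Rightarrow> ('x \<Rightarrow> complex) \<Rightarrow> complex) \<Rightarrow>
   nat \<Rightarrow> (nat \<Rightarrow> 'x) \<Rightarrow> (nat \<Rightarrow> complex) \<Rightarrow> complex mat" where
  "pick_matrix H ip N l \<omega> = mat N N (\<lambda>(i, j).
    (1 - \<omega> i * cnj (\<omega> j)) * ip (rep_kernel H ip (l j)) (rep_kernel H ip (l i)))"

definition pick_uniqueness_kernel ::
  "'x set \<Rightarrow> ('x \<Rightarrow> complex) set \<Rightarrow> (('x \<Rightarrow> complex) \<Rightarrow> ('x \<Rightarrow> complex) \<Rightarrow> complex) \<Rightarrow> bool" where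
  "pick_uniqueness_kernel X H ip \<longleftrightarrow>
    (\<forall>N l \<omega>. np_problem X N l \<omega> \<longrightarrow> (\<exists>\<phi>. np_solution X H ip N l \<omega> \<phi>) \<longrightarrow>
      det (pick_matrix H ip N l \<omega>) = 0 \<longrightarrow> (\<exists>!\<phi>. np_solution X H ip N l \<omega> \<phi>))"

end

theory Submission
  imports Defs
begin

text \<open>
  Let \<open>a\<close> be a non-zero null vector of the Pick matrix with nodes \<open>l i\<close> and targets \<open>\<omega> i\<close>, and
  consider the two elements \<open>f = (\<Sum>i. a i * k i)\<close> and \<open>g = (\<Sum>i. a i * cnj (\<omega> i) * k i)\<close> of the
  Hilbert space, where \<open>k i\<close> is the kernel function at \<open>l i\<close>. If \<open>\<phi>\<close> is a solution, then \<open>g\<close> is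
  the image of \<open>f\<close> under the adjoint of multiplication by \<open>\<phi>\<close>. The quadratic form of the Pick
  matrix at \<open>a\<close> is the squared norm of \<open>f\<close> minus that of \<open>g\<close>, so the contractive adjoint attains
  its bound at \<open>f\<close>. Equality in this bound forces \<open>\<phi> * g = f\<close> (lemma \<open>multiplier_extremal\<close>).

  Neither \<open>f\<close> nor \<open>g\<close> depends on \<open>\<phi>\<close>. Two solutions thus have the same product with \<open>g\<close>, and they
  agree wherever \<open>f\<close> does not vanish, since \<open>g\<close> cannot vanish there either. After dropping the
  indices with \<open>a i = 0\<close>, the function \<open>f\<close> is a combination of kernel functions with non-zero
  coefficients, so the hypothesis applies to it and the two solutions coincide.

  The adjoint is never formed: the reproducing property gives every inner product that is needed.
  This property itself is the Riesz representation theorem for point evaluations, which is proved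
  by minimizing \<open>\<parallel>f\<parallel>\<^sup>2 - 2 Re (f x)\<close> over \<open>H\<close> (lemma \<open>ex_representer\<close>).
\<close>

section \<open>Inner product calculus in a Hilbert function space\<close>

context hilbert_function_space
begin

lemma ip_add_right:
  assumes "f \<in> H" "g \<in> H" "h \<in> H"
  shows "ip h (\<lambda>x. f x + g x) = ip h f + ip h g"
  using assms ip_add[of f g h] ip_cnj add_mem complex_cnj_add by metis

lemma ip_scale_right:
  assumes "f \<in> H" "h \<in> H"
  shows "ip h (\<lambda>x. c * f x) = cnj c * ip h f"
  using assms ip_scale[of f h c] ip_cnj scale_mem complex_cnj_mult by metis

lemma diff_mem: "\<lbrakk>f \<in> H; g \<in> H\<rbrakk> \<Longrightarrow> (\<lambda>x. f x - g x) \<in> H"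
  using add_mem[of f "\<lambda>x. (-1) * g x"] scale_mem[of g "-1"] by simp

lemma ip_diff_right:
  assumes "f \<in> H" "g \<in> H" "h \<in> H"
  shows "ip h (\<lambda>x. f x - g x) = ip h f - ip h g"
  using assms ip_add_right[of f "\<lambda>x. (-1) * g x" h] ip_scale_right[of g h "-1"]
    scale_mem[of g "-1"] by simp

lemma ip_zero: "h \<in> H \<Longrightarrow> ip (\<lambda>x. 0) h = 0"
  using ip_scale[of "\<lambda>x. 0" h 0] zero_mem by simp

lemma ip_self_nonneg: "f \<in> H \<Longrightarrow> 0 \<le> Re (ip f f)"
  using ip_pos[of f] ip_zero[of f] by (cases "f = (\<lambda>x. 0)") auto

lemma ip_self_eq_0: "\<lbrakk>f \<in> H; Re (ip f f) \<le> 0\<rbrakk> \<Longrightarrow> f = (\<lambda>x. 0)"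
  using ip_pos[of f] by fastforce

lemma ip_norm_nonneg: "f \<in> H \<Longrightarrow> 0 \<le> ip_norm ip f"
  unfolding ip_norm_def by (simp add: ip_self_nonneg)

lemma ip_norm_square: "f \<in> H \<Longrightarrow> (ip_norm ip f)\<^sup>2 = Re (ip f f)"
  unfolding ip_norm_def by (simp add: ip_self_nonneg)

text \<open>
  Particular \<open>s\<close> and \<open>t\<close> give the squared norms of differences and midpoints, from which the
  parallelogram law, the Cauchy-Schwarz inequality and first variations are obtained.
\<close>

lemma ip_self_combination:
  assumes "f \<in> H" "g \<in> H"
  shows "Re (ip (\<lambda>x. of_real s * f x + of_real t * g x) (\<lambda>x. of_real s * f x + of_real t * g x))
    = s\<^sup>2 * Re (ip f f) + 2 * s * t * Re (ip f g) + t\<^sup>2 * Re (ip g g)"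
proof -
  let ?f = "\<lambda>x. of_real s * f x" and ?g = "\<lambda>x. of_real t * g x"
  have m: "?f \<in> H" "?g \<in> H" using assms scale_mem by auto
  have "ip (\<lambda>x. ?f x + ?g x) (\<lambda>x. ?f x + ?g x) = ip ?f ?f + ip ?f ?g + (ip ?g ?f + ip ?g ?g)"
    using m by (simp add: ip_add ip_add_right add_mem)
  moreover have "ip ?f ?f = of_real (s * s) * ip f f" "ip ?f ?g = of_real (s * t) * ip f g"
    "ip ?g ?f = of_real (s * t) * cnj (ip f g)" "ip ?g ?g = of_real (t * t) * ip g g"
    using assms m ip_cnj[of f g] by (simp_all add: ip_scale ip_scale_right)
  ultimately show ?thesis
    by (simp add: power2_eq_square algebra_simps)
qed

lemma ip_self_diff:
  assumes "f \<in> H" "g \<in> H"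
  shows "Re (ip (\<lambda>x. f x - g x) (\<lambda>x. f x - g x)) = Re (ip f f) - 2 * Re (ip f g) + Re (ip g g)"
  using ip_self_combination[OF assms, of 1 "-1"] by simp

lemma sum_mem:
  assumes "\<And>i. i < n \<Longrightarrow> g i \<in> H"
  shows "(\<lambda>x. \<Sum>i<(n::nat). a i * g i x) \<in> H"
  using assms
proof (induction n)
  case 0
  then show ?case by (simp add: zero_mem)
next
  case (Suc n)
  then show ?case by (simp add: add_mem scale_mem)
qed

lemma ip_sum_right:
  assumes "\<And>i. i < n \<Longrightarrow> g i \<in> H" and "h \<in> H"
  shows "ip h (\<lambda>x. \<Sum>i<(n::nat). a i * g i x) = (\<Sum>i<n. cnj (a i) * ip h (g i))"
  using assms(1)
proof (induction n)
  case 0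
  then show ?case using ip_zero[OF assms(2)] ip_cnj[OF zero_mem assms(2)] by simp
next
  case (Suc n)
  then show ?case using assms(2) by (simp add: ip_add_right ip_scale_right scale_mem sum_mem)
qed

text \<open>
  By the Cauchy-Schwarz inequality, norm convergence implies weak convergence.
  This lets a first variation pass to the limit of a minimizing sequence.
\<close>

lemma ip_tendsto:
  assumes "\<And>n. u n \<in> H" "k \<in> H" "h \<in> H"
    and lim: "(\<lambda>n. ip_norm ip (\<lambda>x. u n x - k x)) \<longlonglongrightarrow> 0"
  shows "(\<lambda>n. Re (ip h (u n))) \<longlonglongrightarrow> Re (ip h k)"
proof -
  have cauchy_schwarz: "\<bar>Re (ip f g)\<bar> \<le> ip_norm ip f * ip_norm ip g" if m: "f \<in> H" "g \<in> H" for f g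
  proof -
    let ?A = "Re (ip f f)" and ?B = "Re (ip f g)" and ?C = "Re (ip g g)"
    have "?B\<^sup>2 \<le> ?A * ?C"
    proof (cases "g = (\<lambda>x. 0)")
      case True
      then have "ip f g = 0" using ip_zero[of f] ip_cnj[of g f] m by simp
      then show ?thesis using ip_self_nonneg m by simp
    next
      case False
      then have C: "?C > 0" using ip_pos m by blast
      \<comment> \<open>The nonnegative square of \<open>C * f - B * g\<close> is \<open>C * (A * C - B\<^sup>2)\<close>.\<close>
      have "0 \<le> ?C\<^sup>2 * ?A + 2 * ?C * (-?B) * ?B + (-?B)\<^sup>2 * ?C"
        unfolding ip_self_combination[OF m, symmetric]
        by (intro ip_self_nonneg add_mem scale_mem m)
      then have "0 \<le> ?C * (?A * ?C - ?B\<^sup>2)"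
        by (simp add: power2_eq_square algebra_simps)
      then show ?thesis using C by (simp add: zero_le_mult_iff)
    qed
    then have "\<bar>?B\<bar>\<^sup>2 \<le> (ip_norm ip f * ip_norm ip g)\<^sup>2"
      using m by (simp add: power_mult_distrib ip_norm_square)
    then show ?thesis
      by (rule power2_le_imp_le) (simp add: m ip_norm_nonneg)
  qed
  have "(\<lambda>n. ip_norm ip h * ip_norm ip (\<lambda>x. u n x - k x)) \<longlonglongrightarrow> 0"
    using tendsto_mult_left[OF lim, of "ip_norm ip h"] by simp
  moreover have "norm (Re (ip h (u n)) - Re (ip h k)) \<le> ip_norm ip h * ip_norm ip (\<lambda>x. u n x - k x)" for n
    using cauchy_schwarz[OF assms(3) diff_mem[OF assms(1,2)], of n] ip_diff_right[OF assms(1,2,3), of n]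
    by simp
  ultimately have "(\<lambda>n. norm (Re (ip h (u n)) - Re (ip h k))) \<longlonglongrightarrow> 0"
    by (intro tendsto_sandwich[where f = "\<lambda>n. 0" and g = "\<lambda>n. norm (Re (ip h (u n)) - Re (ip h k))"])
      simp_all
  then have "(\<lambda>n. Re (ip h (u n)) - Re (ip h k)) \<longlonglongrightarrow> 0"
    by (rule tendsto_norm_zero_cancel)
  then show ?thesis by (simp add: LIM_zero_iff)
qed

section \<open>Existence of the reproducing kernel\<close>

text \<open>
  The functional \<open>J f = \<parallel>f\<parallel>\<^sup>2 - 2 Re (f p)\<close> is bounded below because evaluation at \<open>p\<close> is bounded.
  Its linear part cancels in the parallelogram law, which makes minimizing sequences Cauchy, and
  the first variation at the limit says that this limit represents the evaluation.
\<close>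

lemma ex_representer:
  assumes p: "p \<in> X"
  shows "\<exists>k\<in>H. \<forall>f\<in>H. ip f k = f p"
proof -
  define J where "J f = Re (ip f f) - 2 * Re (f p)" for f
  obtain C where C: "\<And>f. f \<in> H \<Longrightarrow> cmod (f p) \<le> C * ip_norm ip f"
    using eval_bounded[OF p] by blast
  have "- C\<^sup>2 \<le> J f" if f: "f \<in> H" for f
  proof -
    have "Re (f p) \<le> C * ip_norm ip f"
      using C[OF f] complex_Re_le_cmod[of "f p"] by linarith
    moreover have "0 \<le> (ip_norm ip f - C)\<^sup>2" by simp
    ultimately show ?thesis
      unfolding J_def using ip_norm_square[OF f] by (simp add: power2_eq_square algebra_simps)
  qed
  then have bdd: "bdd_below (J ` H)" by (auto simp: bdd_below_def)
  define m where "m = Inf (J ` H)"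
  have m_le: "m \<le> J f" if "f \<in> H" for f
    unfolding m_def using bdd that by (auto intro: cInf_lower)
  have "\<exists>f\<in>H. J f < m + inverse (Suc n)" for n
    using cInf_lessD[of "J ` H" "m + inverse (Suc n)"] zero_mem unfolding m_def by force
  then obtain u where u: "\<And>n. u n \<in> H" and Ju: "\<And>n. J (u n) < m + inverse (Suc n)"
    by metis
  have gap: "(ip_norm ip (\<lambda>x. f x - g x))\<^sup>2 \<le> 2 * (J f - m) + 2 * (J g - m)"
    if fg: "f \<in> H" "g \<in> H" for f g
  proof -
    let ?h = "\<lambda>x. of_real (1/2) * f x + of_real (1/2) * g x"
    have "?h \<in> H" using fg by (intro add_mem scale_mem)
    then have "m \<le> J ?h" by (rule m_le)
    also have "J ?h = Re (ip f f) / 4 + Re (ip f g) / 2 + Re (ip g g) / 4 - Re (f p) - Re (g p)"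
      unfolding J_def ip_self_combination[OF fg] by (simp add: power2_eq_square)
    finally show ?thesis
      unfolding ip_norm_square[OF diff_mem[OF fg]] ip_self_diff[OF fg] J_def by simp
  qed
  have "\<exists>M. \<forall>i\<ge>M. \<forall>j\<ge>M. ip_norm ip (\<lambda>x. u i x - u j x) < e" if e: "e > 0" for e
  proof -
    obtain M where M: "inverse (real (Suc M)) < e\<^sup>2 / 4"
      using reals_Archimedean[of "e\<^sup>2 / 4"] e by auto
    have small: "J (u i) - m < e\<^sup>2 / 4" if "i \<ge> M" for i
    proof -
      have "inverse (real (Suc i)) \<le> inverse (real (Suc M))" using that by (simp add: field_simps)
      then show ?thesis using Ju[of i] M by linarith
    qed
    have "ip_norm ip (\<lambda>x. u i x - u j x) < e" if "i \<ge> M" "j \<ge> M" for i j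
    proof -
      have "(ip_norm ip (\<lambda>x. u i x - u j x))\<^sup>2 < e\<^sup>2"
      proof (rule le_less_trans[OF gap[OF u u]])
        show "2 * (J (u i) - m) + 2 * (J (u j) - m) < e\<^sup>2"
          using small[OF that(1)] small[OF that(2)] by argo
      qed
      then show ?thesis using e power2_less_imp_less by (metis less_imp_le)
    qed
    then show ?thesis by blast
  qed
  then obtain k where k: "k \<in> H" and lim: "(\<lambda>n. ip_norm ip (\<lambda>x. u n x - k x)) \<longlonglongrightarrow> 0"
    using complete[of u] u by blast
  have variation: "0 \<le> 2 * t * (Re (ip h k) - Re (h p)) + t\<^sup>2 * Re (ip h h)" if h: "h \<in> H" for h t
  proof -
    have "- inverse (real (Suc n)) \<le> 2 * t * (Re (ip h (u n)) - Re (h p)) + t\<^sup>2 * Re (ip h h)" for n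
    proof -
      let ?v = "\<lambda>x. of_real t * h x + of_real 1 * u n x"
      have "m \<le> J ?v" using h u by (intro m_le add_mem scale_mem)
      also have "J ?v = J (u n) + 2 * t * (Re (ip h (u n)) - Re (h p)) + t\<^sup>2 * Re (ip h h)"
        unfolding J_def ip_self_combination[OF h u] by (simp add: algebra_simps)
      finally show ?thesis using Ju[of n] by linarith
    qed
    moreover have "(\<lambda>n. - inverse (real (Suc n))) \<longlonglongrightarrow> 0"
      using tendsto_minus[OF LIMSEQ_inverse_real_of_nat] by simp
    moreover have "(\<lambda>n. 2 * t * (Re (ip h (u n)) - Re (h p)) + t\<^sup>2 * Re (ip h h))
        \<longlonglongrightarrow> 2 * t * (Re (ip h k) - Re (h p)) + t\<^sup>2 * Re (ip h h)"
      by (intro tendsto_intros ip_tendsto[OF u k h lim])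
    ultimately show ?thesis
      by (meson LIMSEQ_le eventually_sequentially order_refl)
  qed
  have re: "Re (ip h k) = Re (h p)" if h: "h \<in> H" for h
  proof -
    let ?b = "Re (ip h k) - Re (h p)" and ?c = "Re (ip h h) + 1"
    have c: "?c > 0" using ip_self_nonneg[OF h] by linarith
    \<comment> \<open>The denominator exceeds \<open>\<parallel>h\<parallel>\<^sup>2\<close>, so that it is positive even for \<open>h = 0\<close>.\<close>
    have "0 \<le> 2 * (- ?b / ?c) * ?b + (- ?b / ?c)\<^sup>2 * Re (ip h h)"
      by (rule variation[OF h])
    also have "\<dots> \<le> 2 * (- ?b / ?c) * ?b + (- ?b / ?c)\<^sup>2 * ?c"
      by (intro add_left_mono mult_left_mono) auto
    also have "\<dots> = - (?b\<^sup>2 / ?c)"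
    proof -
      have "2 * (- b / c) * b + (- b / c)\<^sup>2 * c = - (b\<^sup>2 / c)" if "c > 0" for b c :: real
        using that by (simp add: power2_eq_square field_simps)
      then show ?thesis using c by blast
    qed
    finally have "?b\<^sup>2 / ?c \<le> 0" by simp
    then have "?b\<^sup>2 \<le> 0" using c by (simp add: divide_le_0_iff)
    then show ?thesis by simp
  qed
  have "ip f k = f p" if f: "f \<in> H" for f
    \<comment> \<open>The imaginary part is the real part for the multiple of \<open>f\<close> by the imaginary unit.\<close>
    using re[OF f] re[OF scale_mem[OF f, of \<i>]] ip_scale[OF f k, of \<i>]
    by (simp add: complex_eq_iff)
  then show ?thesis using k by blast
qed

lemma rep_kernel:
  assumes "p \<in> X"
  shows rep_kernel_mem: "rep_kernel H ip p \<in> H"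
    and ip_rep_kernel: "f \<in> H \<Longrightarrow> ip f (rep_kernel H ip p) = f p"
proof -
  have "\<exists>!k. k \<in> H \<and> (\<forall>f\<in>H. ip f k = f p)"
  proof (rule ex_ex1I)
    show "\<exists>k. k \<in> H \<and> (\<forall>f\<in>H. ip f k = f p)" using ex_representer[OF assms] by blast
    fix k k' assume k: "k \<in> H \<and> (\<forall>f\<in>H. ip f k = f p)" and k': "k' \<in> H \<and> (\<forall>f\<in>H. ip f k' = f p)"
    then have "(\<lambda>x. k x - k' x) = (\<lambda>x. 0)"
      by (intro ip_self_eq_0) (auto simp: diff_mem ip_diff_right)
    then show "k = k'" by (metis eq_iff_diff_eq_0 ext)
  qed
  from theI'[OF this]
  show "rep_kernel H ip p \<in> H" "f \<in> H \<Longrightarrow> ip f (rep_kernel H ip p) = f p"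
    unfolding rep_kernel_def by auto
qed

lemma ip_rep_kernel_sum:
  assumes "\<And>i. i < n \<Longrightarrow> l i \<in> X" and "h \<in> H"
  shows "ip h (\<lambda>x. \<Sum>i<(n::nat). a i * rep_kernel H ip (l i) x) = (\<Sum>i<n. cnj (a i) * h (l i))"
  using assms by (simp add: ip_sum_right rep_kernel_mem ip_rep_kernel)

section \<open>Extremal vectors of contractive multipliers\<close>

lemma Mult1_mult_mem: "\<lbrakk>\<phi> \<in> Mult1 X H ip; f \<in> H\<rbrakk> \<Longrightarrow> (\<lambda>x. \<phi> x * f x) \<in> H"
  unfolding Mult1_def Mult_def by auto

lemma Mult1_contractive:
  assumes phi: "\<phi> \<in> Mult1 X H ip" and f: "f \<in> H"
  shows "Re (ip (\<lambda>x. \<phi> x * f x) (\<lambda>x. \<phi> x * f x)) \<le> Re (ip f f)"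
proof (cases "f = (\<lambda>x. 0)")
  case True
  then show ?thesis by simp
next
  case False
  let ?n = "ip_norm ip f"
  let ?g = "\<lambda>x. of_real (1 / ?n) * f x"
  let ?p = "\<lambda>x. \<phi> x * f x"
  have n: "?n > 0" unfolding ip_norm_def using ip_pos[OF f False] by simp
  have scaled: "ip_norm ip (\<lambda>x. of_real (1 / ?n) * h x) = ip_norm ip h / ?n" if h: "h \<in> H" for h
  proof -
    have "Re (ip (\<lambda>x. of_real (1 / ?n) * h x) (\<lambda>x. of_real (1 / ?n) * h x)) = (1 / ?n)\<^sup>2 * Re (ip h h)"
      using ip_self_combination[OF h h, of "1 / ?n" 0] by simp
    then show ?thesis
      unfolding ip_norm_def[of ip h] ip_norm_def[of ip "\<lambda>x. of_real (1 / ?n) * h x"]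
      using n by (simp add: real_sqrt_mult real_sqrt_divide)
  qed
  have p: "?p \<in> H" by (rule Mult1_mult_mem[OF phi f])
  have g: "?g \<in> H" by (rule scale_mem[OF f])
  moreover have "ip_norm ip ?g \<le> 1" using scaled[OF f] n by simp
  ultimately have "ereal (ip_norm ip (\<lambda>x. \<phi> x * ?g x)) \<le> mult_norm H ip \<phi>"
    unfolding mult_norm_def by (intro SUP_upper) auto
  also have "\<dots> \<le> 1" using phi unfolding Mult1_def by simp
  also have "(\<lambda>x. \<phi> x * ?g x) = (\<lambda>x. of_real (1 / ?n) * ?p x)" by (simp add: mult_ac)
  finally have "ip_norm ip ?p \<le> ?n" using scaled[OF p] n by simp
  then have "(ip_norm ip ?p)\<^sup>2 \<le> ?n\<^sup>2" by (intro power_mono ip_norm_nonneg p)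
  then show ?thesis by (simp add: ip_norm_square p f)
qed

text \<open>
  The equations \<open>null\<close> say that \<open>a\<close> is a null vector of the Pick matrix. Both \<open>\<parallel>f\<parallel>\<^sup>2\<close> and \<open>\<parallel>g\<parallel>\<^sup>2\<close>
  and the inner product of \<open>\<phi> * g\<close> with \<open>f\<close> equal the same sum over the nodes. As multiplication by
  \<open>\<phi>\<close> is contractive, \<open>\<parallel>\<phi> * g - f\<parallel>\<^sup>2 \<le> \<parallel>g\<parallel>\<^sup>2 - 2 \<parallel>g\<parallel>\<^sup>2 + \<parallel>g\<parallel>\<^sup>2 = 0\<close>.
\<close>

lemma multiplier_extremal:
  fixes n :: nat and l :: "nat \<Rightarrow> 'x" and a \<omega> :: "nat \<Rightarrow> complex"
  defines "f \<equiv> \<lambda>x. \<Sum>i<n. a i * rep_kernel H ip (l i) x"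
    and "g \<equiv> \<lambda>x. \<Sum>i<n. a i * cnj (\<omega> i) * rep_kernel H ip (l i) x"
  assumes phi: "\<phi> \<in> Mult1 X H ip"
    and l: "\<And>i. i < n \<Longrightarrow> l i \<in> X"
    and interp: "\<And>i. i < n \<Longrightarrow> \<phi> (l i) = \<omega> i"
    and null: "\<And>i. i < n \<Longrightarrow> f (l i) = \<omega> i * g (l i)"
  shows "\<phi> x * g x = f x"
proof -
  let ?s = "\<Sum>i<n. cnj (a i) * (\<omega> i * g (l i))"
  let ?p = "\<lambda>x. \<phi> x * g x"
  have f: "f \<in> H" and g: "g \<in> H"
    unfolding f_def g_def by (simp_all add: sum_mem rep_kernel_mem l)
  have p: "?p \<in> H" by (rule Mult1_mult_mem[OF phi g])
  have ip_f: "ip h f = (\<Sum>i<n. cnj (a i) * h (l i))" if "h \<in> H" for h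
    using ip_rep_kernel_sum[OF l that, where a = a] unfolding f_def by simp
  have "ip f f = ?s" using ip_f[OF f] null by simp
  moreover have "ip ?p f = ?s" using ip_f[OF p] interp by simp
  moreover have "ip g g = ?s"
    using ip_rep_kernel_sum[OF l g, where a = "\<lambda>i. a i * cnj (\<omega> i)"] unfolding g_def
    by (simp add: mult_ac)
  ultimately have "Re (ip (\<lambda>x. ?p x - f x) (\<lambda>x. ?p x - f x)) \<le> 0"
    using Mult1_contractive[OF phi g] ip_self_diff[OF p f] by simp
  then have "(\<lambda>x. ?p x - f x) = (\<lambda>x. 0)"
    by (intro ip_self_eq_0 diff_mem p f)
  then show ?thesis by (metis eq_iff_diff_eq_0)
qed

lemma singular_pick_matrix_null_vector:
  assumes l: "\<And>i. i < N \<Longrightarrow> l i \<in> X" and det: "det (pick_matrix H ip N l \<omega>) = 0"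
  obtains a where "\<exists>i<N. a i \<noteq> 0"
    and "\<And>i. i < N \<Longrightarrow> (\<Sum>j<N. a j * rep_kernel H ip (l j) (l i))
      = \<omega> i * (\<Sum>j<N. a j * cnj (\<omega> j) * rep_kernel H ip (l j) (l i))"
proof -
  have carrier: "pick_matrix H ip N l \<omega> \<in> carrier_mat N N"
    unfolding pick_matrix_def by simp
  obtain v where v: "v \<in> carrier_vec N" "v \<noteq> 0\<^sub>v N" "pick_matrix H ip N l \<omega> *\<^sub>v v = 0\<^sub>v N"
    using det det_0_iff_vec_prod_zero[OF carrier] by blast
  show ?thesis
  proof
    show "\<exists>i<N. v $ i \<noteq> 0" using v(1,2) by auto
    fix i assume i: "i < N"
    have "0 = (pick_matrix H ip N l \<omega> *\<^sub>v v) $ i" using v(3) i by simp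
    also have "\<dots> = (\<Sum>j<N. (1 - \<omega> i * cnj (\<omega> j)) * rep_kernel H ip (l j) (l i) * v $ j)"
      using i v(1) l
      by (simp add: pick_matrix_def scalar_prod_def atLeast0LessThan ip_rep_kernel rep_kernel_mem)
    also have "\<dots> = (\<Sum>j<N. v $ j * rep_kernel H ip (l j) (l i))
        - \<omega> i * (\<Sum>j<N. v $ j * cnj (\<omega> j) * rep_kernel H ip (l j) (l i))"
      by (simp add: sum_distrib_left sum_subtractf algebra_simps)
    finally show "(\<Sum>j<N. v $ j * rep_kernel H ip (l j) (l i))
        = \<omega> i * (\<Sum>j<N. v $ j * cnj (\<omega> j) * rep_kernel H ip (l j) (l i))"
      by simp
  qed
qed

end

section \<open>Uniqueness of the solution\<close>

theorem theorem1p5: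
  fixes X :: "'x set"
    and H :: "('x \<Rightarrow> complex) set"
    and ip :: "('x \<Rightarrow> complex) \<Rightarrow> ('x \<Rightarrow> complex) \<Rightarrow> complex"
  assumes "hilbert_function_space X H ip"
    and "\<And>(N :: nat) (l :: nat \<Rightarrow> 'x) (a :: nat \<Rightarrow> complex).
      \<lbrakk>N \<ge> 1; \<forall>i<N. l i \<in> X; inj_on l {..<N}; \<forall>i<N. a i \<noteq> 0\<rbrakk> \<Longrightarrow>
      uniqueness_set X H (X - {x \<in> X. (\<Sum>i<N. a i * rep_kernel H ip (l i) x) = 0})"
  shows "pick_uniqueness_kernel X H ip"
proof -
  interpret hilbert_function_space X H ip by fact
  have "\<phi> = \<psi>" if np: "np_problem X N l \<omega>" and det: "det (pick_matrix H ip N l \<omega>) = 0"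
    and phi: "np_solution X H ip N l \<omega> \<phi>" and psi: "np_solution X H ip N l \<omega> \<psi>" for N l \<omega> \<phi> \<psi>
  proof -
    have l: "\<And>i. i < N \<Longrightarrow> l i \<in> X" and inj: "inj_on l {..<N}"
      using np unfolding np_problem_def by auto
    obtain a where nz: "\<exists>i<N. a i \<noteq> 0"
      and null: "\<And>i. i < N \<Longrightarrow> (\<Sum>j<N. a j * rep_kernel H ip (l j) (l i))
        = \<omega> i * (\<Sum>j<N. a j * cnj (\<omega> j) * rep_kernel H ip (l j) (l i))"
      using singular_pick_matrix_null_vector[where l = l, OF l det] by blast
    define f where "f = (\<lambda>x. \<Sum>i<N. a i * rep_kernel H ip (l i) x)"
    define g where "g = (\<lambda>x. \<Sum>i<N. a i * cnj (\<omega> i) * rep_kernel H ip (l i) x)"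
    have solves: "\<chi> x * g x = f x" if "np_solution X H ip N l \<omega> \<chi>" for \<chi> x
      unfolding f_def g_def
      using multiplier_extremal[of \<chi> N l \<omega> a x] that l null unfolding np_solution_def by simp
    \<comment> \<open>The hypothesis wants all coefficients non-zero, so the support of \<open>a\<close> is renumbered.\<close>
    define S where "S = {i. i < N \<and> a i \<noteq> 0}"
    have fin: "finite S" unfolding S_def by simp
    have S: "S \<noteq> {}" "S \<subseteq> {..<N}" using nz unfolding S_def by auto
    obtain e where e: "bij_betw e {..<card S} S"
      using ex_bij_betw_nat_finite[OF fin] by (auto simp: atLeast0LessThan)
    have e_mem: "e i \<in> S" if "i < card S" for i
      using e that by (auto simp: bij_betw_def)
    have f_eq: "(\<Sum>i<card S. a (e i) * rep_kernel H ip (l (e i)) x) = f x" for x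
    proof -
      have "(\<Sum>i<card S. a (e i) * rep_kernel H ip (l (e i)) x) = (\<Sum>i\<in>S. a i * rep_kernel H ip (l i) x)"
        by (rule sum.reindex_bij_betw[OF e])
      also have "\<dots> = f x"
        unfolding f_def S_def by (rule sum.mono_neutral_left) auto
      finally show ?thesis .
    qed
    have "uniqueness_set X H
      (X - {x \<in> X. (\<Sum>i<card S. (a \<circ> e) i * rep_kernel H ip ((l \<circ> e) i) x) = 0})"
    proof (rule assms(2))
      show "card S \<ge> 1" using fin S by (simp add: Suc_le_eq card_gt_0_iff)
      show "\<forall>i<card S. (l \<circ> e) i \<in> X" using e_mem l unfolding S_def by auto
      show "inj_on (l \<circ> e) {..<card S}"
        using e inj S(2) by (auto simp: bij_betw_def intro!: comp_inj_on intro: inj_on_subset)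
      show "\<forall>i<card S. (a \<circ> e) i \<noteq> 0" using e_mem unfolding S_def by auto
    qed
    then have uniq: "uniqueness_set X H (X - {x \<in> X. f x = 0})" by (simp add: f_eq)
    have "\<phi> x = \<psi> x" if "f x \<noteq> 0" for x
    proof -
      have "\<phi> x * g x = \<psi> x * g x" using solves[OF phi] solves[OF psi] by simp
      moreover have "g x \<noteq> 0" using solves[OF phi, of x] that by auto
      ultimately show ?thesis by simp
    qed
    moreover have "\<phi> \<in> Mult X H" "\<psi> \<in> Mult X H"
      using phi psi unfolding np_solution_def Mult1_def by auto
    ultimately show ?thesis using uniq unfolding uniqueness_set_def by blast
  qed
  then show ?thesis unfolding pick_uniqueness_kernel_def by blast
qed

end
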